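(* Let $M$ be an $n\times n$ irreducible, real (symmetric) positive definite matrix. Then $$\#(M)+\#(M^{-1})\ \ge\ 8n-8 .$$
   Context: $\#(A)$ denotes the number of nonzero entries of the matrix $A$. Positive definite matrices are by definition real symmetric. An $n\times n$ matrix $A$ is reducible if there is a permutation matrix $P$ such that $PAP^\top=\begin{bmatrix}A_{11}&A_{12}\\O&A_{22}\end{bmatrix}$ with $A_{11},A_{22}$ square and non-vacuous; it is irreducible if it is not reducible (in particular every $1\times1$ matrix is irreducible). *)

theory Defs
  imports
    "HOL-Combinatorics.Permutations"
    "Jordan_Normal_Form.Determinant"
    "Jordan_Normal_Form.Gauss_Jordan_Elimination"
begin

definition nnz :: "'a :: zero mat \<Rightarrow> nat" where
  "nnz A = card {(i, j). i < dim_row A \<and> j < dim_col A \<and> A $$ (i, j) \<noteq> 0}"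

definition permutation_mat :: "nat \<Rightarrow> 'a :: {zero, one} mat \<Rightarrow> bool" where
  "permutation_mat n P \<longleftrightarrow>
    (\<exists>p. p permutes {0..<n} \<and> P = mat n n (\<lambda>(i, j). if j = p i then 1 else 0))"

definition reducible_mat :: "'a :: comm_ring_1 mat \<Rightarrow> bool" where
  "reducible_mat A \<longleftrightarrow>
    (\<exists>k m P A11 A12 A22. k > 0 \<and> m > 0 \<and> A \<in> carrier_mat (k + m) (k + m) \<and>
       permutation_mat (k + m) P \<and>
       A11 \<in> carrier_mat k k \<and> A12 \<in> carrier_mat k m \<and> A22 \<in> carrier_mat m m \<and>
       P * A * transpose_mat P = four_block_mat A11 A12 (0\<^sub>m m k) A22)"

definition irreducible_mat :: "'a :: comm_ring_1 mat \<Rightarrow> bool" where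
  "irreducible_mat A \<longleftrightarrow> square_mat A \<and> \<not> reducible_mat A"

definition positive_definite_mat :: "real mat \<Rightarrow> bool" where
  "positive_definite_mat A \<longleftrightarrow> square_mat A \<and> transpose_mat A = A \<and>
    (\<forall>v \<in> carrier_vec (dim_row A). v \<noteq> 0\<^sub>v (dim_row A) \<longrightarrow> v \<bullet> (A *\<^sub>v v) > 0)"

text \<open>A positive definite matrix is invertible, so \<open>the (mat_inverse A)\<close> is its genuine
  two-sided inverse, never the unspecified value \<open>the None\<close>.\<close>

lemma positive_definite_mat_inverse:
  assumes A: "A \<in> carrier_mat n n" and pd: "positive_definite_mat A"
  shows "mat_inverse A = Some (the (mat_inverse A))"
    and "the (mat_inverse A) \<in> carrier_mat n n"
    and "A * the (mat_inverse A) = 1\<^sub>m n"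
    and "the (mat_inverse A) * A = 1\<^sub>m n"
proof -
  have "det A \<noteq> 0"
  proof
    assume "det A = 0"
    then obtain v where v: "v \<in> carrier_vec n" "v \<noteq> 0\<^sub>v n" "A *\<^sub>v v = 0\<^sub>v n"
      using det_0_iff_vec_prod_zero[OF A] by blast
    then have "v \<bullet> (A *\<^sub>v v) > 0"
      using pd A unfolding positive_definite_mat_def by auto
    then show False using v by simp
  qed
  then have "A \<in> Units (ring_mat TYPE(real) n ())"
    by (rule det_non_zero_imp_unit[OF A])
  then have "mat_inverse A \<noteq> None"
    using mat_inverse(1)[OF A, of "()"] by blast
  then show *: "mat_inverse A = Some (the (mat_inverse A))" by simp
  from mat_inverse(2)[OF A *]
  show "the (mat_inverse A) \<in> carrier_mat n n" "A * the (mat_inverse A) = 1\<^sub>m n"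
    "the (mat_inverse A) * A = 1\<^sub>m n" by auto
qed

lemma irreducible_mat_1x1:
  assumes "A \<in> carrier_mat 1 1"
  shows "irreducible_mat A"
  using assms by (auto simp: irreducible_mat_def reducible_mat_def)

end

theory Submission
  imports Defs
begin

text \<open>
  Let \<open>N\<close> be the inverse of \<open>M\<close>, and read the off-diagonal nonzero entries of \<open>M\<close> and \<open>N\<close> as
  the edges of two graphs on the same \<open>n\<close> vertices. The graph of \<open>M\<close> is connected because \<open>M\<close> is
  irreducible, and the graph of \<open>N\<close> then is connected too: a zero off-diagonal block of one
  matrix of an inverse pair is zero in the other. Since diagonal entries are positive, the claim
  says that the two graphs together have at least \<open>3 * n - 4\<close> edges. If every degree in both
  graphs is at least 3, each row of either matrix has at least 4 nonzero entries and the count is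
  at least \<open>8 * n\<close>. Otherwise some vertex \<open>v\<close> has degree 1 or 2 in one graph, and since the
  hypotheses are symmetric it may be taken to be the graph of \<open>M\<close>. Induction on \<open>n\<close> removes \<open>v\<close>.

  Removing \<open>v\<close> from \<open>N\<close> corresponds to replacing \<open>M\<close> by its Schur complement \<open>K\<close> at \<open>v\<close>, which
  changes \<open>M\<close> only at pairs of neighbours of \<open>v\<close>. If \<open>v\<close> has a single neighbour, \<open>K\<close> has the
  zero pattern of \<open>M\<close> without \<open>v\<close> (lemma \<open>leaf_step\<close>). If \<open>v\<close> has two neighbours \<open>u\<close> and \<open>w\<close>,
  only the edge \<open>uw\<close> can appear or disappear (lemma \<open>degree_two_step\<close>), so the loss of edges is
  under control as long as \<open>K\<close> stays connected. It can become disconnected only when the edge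
  \<open>uw\<close> was a bridge and is cancelled; then both \<open>K\<close> and \<open>N\<close> without \<open>v\<close> split into two blocks,
  and the induction hypothesis is used on each (lemma \<open>split_step\<close>). The bound for two blocks
  loses a constant, which is regained from the degree of \<open>v\<close> in \<open>N\<close>: the orthogonality of row
  \<open>v\<close> of \<open>M\<close> to the columns of \<open>N\<close> forces row \<open>v\<close> of \<open>N\<close> to be nonzero wherever row \<open>u\<close> is
  nonzero in the block of \<open>u\<close> or row \<open>w\<close> in the block of \<open>w\<close>.

  The induction passes to arbitrary subsets of the index set, hence the argument works with
  functions of two indices restricted to a finite set, and only the last part translates the
  result to matrices.
\<close>

section \<open>Inverse pairs of positive definite matrices on a finite index set\<close>

definition nonzeros :: "'a set \<Rightarrow> ('a \<Rightarrow> 'a \<Rightarrow> real) \<Rightarrow> nat" where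
  "nonzeros V M = card {(i, j). i \<in> V \<and> j \<in> V \<and> M i j \<noteq> 0}"

definition neighbours :: "'a set \<Rightarrow> ('a \<Rightarrow> 'a \<Rightarrow> real) \<Rightarrow> 'a \<Rightarrow> 'a set" where
  "neighbours V M v = {j \<in> V - {v}. M v j \<noteq> 0}"

text \<open>Connectedness of the graph of nonzero entries, phrased through cuts because a cut without
  crossing edges is exactly a zero block of the matrix.\<close>
definition connected_on :: "'a set \<Rightarrow> ('a \<Rightarrow> 'a \<Rightarrow> real) \<Rightarrow> bool" where
  "connected_on V M \<longleftrightarrow> (\<forall>A. A \<subset> V \<and> A \<noteq> {} \<longrightarrow> (\<exists>i\<in>A. \<exists>j\<in>V - A. M i j \<noteq> 0))"

definition pos_def_on :: "'a set \<Rightarrow> ('a \<Rightarrow> 'a \<Rightarrow> real) \<Rightarrow> bool" where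
  "pos_def_on V M \<longleftrightarrow> (\<forall>i\<in>V. \<forall>j\<in>V. M i j = M j i) \<and>
     (\<forall>x. (\<exists>i\<in>V. x i \<noteq> 0) \<longrightarrow> (\<Sum>i\<in>V. \<Sum>j\<in>V. x i * M i j * x j) > 0)"

definition inverse_pair_on :: "'a set \<Rightarrow> ('a \<Rightarrow> 'a \<Rightarrow> real) \<Rightarrow> ('a \<Rightarrow> 'a \<Rightarrow> real) \<Rightarrow> bool" where
  "inverse_pair_on V M N \<longleftrightarrow> finite V \<and> pos_def_on V M \<and> pos_def_on V N \<and>
     (\<forall>i\<in>V. \<forall>j\<in>V. (\<Sum>k\<in>V. M i k * N k j) = (if i = j then 1 else 0))"

definition schur_complement :: "'a \<Rightarrow> ('a \<Rightarrow> 'a \<Rightarrow> real) \<Rightarrow> 'a \<Rightarrow> 'a \<Rightarrow> real" where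
  "schur_complement v M i j = M i j - M i v * M v j / M v v"

lemma pos_def_on_sym: "pos_def_on V M \<Longrightarrow> i \<in> V \<Longrightarrow> j \<in> V \<Longrightarrow> M i j = M j i"
  by (auto simp: pos_def_on_def)

lemma pos_def_on_pos:
  "pos_def_on V M \<Longrightarrow> i \<in> V \<Longrightarrow> x i \<noteq> 0 \<Longrightarrow> (\<Sum>i\<in>V. \<Sum>j\<in>V. x i * M i j * x j) > 0"
  by (auto simp: pos_def_on_def)

lemma pos_def_on_subset:
  assumes "finite V" "pos_def_on V M" "A \<subseteq> V"
  shows "pos_def_on A M"
  unfolding pos_def_on_def
proof (intro conjI allI impI ballI)
  fix i j assume "i \<in> A" "j \<in> A"
  then show "M i j = M j i" using assms(3) by (intro pos_def_on_sym[OF assms(2)]) auto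
next
  fix x :: "'a \<Rightarrow> real" assume "\<exists>i\<in>A. x i \<noteq> 0"
  define y where "y = (\<lambda>i. if i \<in> A then x i else 0)"
  have "\<exists>i\<in>V. y i \<noteq> 0" using \<open>\<exists>i\<in>A. x i \<noteq> 0\<close> assms by (auto simp: y_def)
  then have "0 < (\<Sum>i\<in>V. \<Sum>j\<in>V. y i * M i j * y j)"
    using assms by (simp add: pos_def_on_def)
  also have "\<dots> = (\<Sum>i\<in>A. \<Sum>j\<in>V. y i * M i j * y j)"
    by (rule sum.mono_neutral_right) (use assms in \<open>auto simp: y_def\<close>)
  also have "\<dots> = (\<Sum>i\<in>A. \<Sum>j\<in>A. y i * M i j * y j)"
    by (intro sum.cong refl sum.mono_neutral_right) (use assms in \<open>auto simp: y_def\<close>)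
  also have "\<dots> = (\<Sum>i\<in>A. \<Sum>j\<in>A. x i * M i j * x j)"
    by (intro sum.cong refl) (auto simp: y_def)
  finally show "(\<Sum>i\<in>A. \<Sum>j\<in>A. x i * M i j * x j) > 0" .
qed

lemma pos_def_on_diag:
  assumes "finite V" "pos_def_on V M" "v \<in> V"
  shows "M v v > 0"
proof -
  have "pos_def_on {v} M" using pos_def_on_subset[OF assms(1,2), of "{v}"] assms(3) by simp
  from pos_def_on_pos[OF this, of v "\<lambda>_. 1"] show ?thesis by simp
qed

text \<open>Given \<open>x\<close> off \<open>v\<close>, the value at \<open>v\<close> that minimises the quadratic form of \<open>M\<close> is
  \<open>- s / M v v\<close>, where \<open>s\<close> pairs row \<open>v\<close> with \<open>x\<close>; the minimum is the quadratic form of the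
  Schur complement.\<close>
lemma pos_def_on_schur_complement:
  assumes fin: "finite V" and pd: "pos_def_on V M" and v: "v \<in> V"
  shows "pos_def_on (V - {v}) (schur_complement v M)"
  unfolding pos_def_on_def
proof (intro conjI allI impI ballI)
  fix i j assume "i \<in> V - {v}" "j \<in> V - {v}"
  then have "M i j = M j i" "M i v = M v i" "M j v = M v j" using v
    by (auto intro: pos_def_on_sym[OF pd])
  then show "schur_complement v M i j = schur_complement v M j i"
    by (simp add: schur_complement_def)
next
  define U where "U = V - {v}"
  fix x :: "'a \<Rightarrow> real" assume "\<exists>i\<in>V - {v}. x i \<noteq> 0"
  define s where "s = (\<Sum>j\<in>U. M v j * x j)"
  define y where "y = x(v := - s / M v v)"
  have mv: "M v v > 0" using assms by (rule pos_def_on_diag)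
  have nz: "\<exists>i\<in>U. x i \<noteq> 0" using \<open>\<exists>i\<in>V - {v}. x i \<noteq> 0\<close> by (simp add: U_def)
  have ins: "V = insert v U" "finite U" "v \<notin> U" using fin v by (auto simp: U_def)
  have s': "(\<Sum>i\<in>U. x i * M i v) = s"
    unfolding s_def by (intro sum.cong refl) (use v pos_def_on_sym[OF pd _ v] in \<open>auto simp: U_def\<close>)
  have "\<exists>i\<in>V. y i \<noteq> 0" using nz ins by (auto simp: y_def)
  then have "0 < (\<Sum>i\<in>V. \<Sum>j\<in>V. y i * M i j * y j)"
    using pd by (simp add: pos_def_on_def)
  also have "\<dots> = (\<Sum>i\<in>insert v U. \<Sum>j\<in>insert v U. y i * M i j * y j)"
    by (simp only: ins(1)[symmetric])
  also have "\<dots> = y v * M v v * y v + (\<Sum>j\<in>U. y v * M v j * y j)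
      + ((\<Sum>i\<in>U. y i * M i v * y v) + (\<Sum>i\<in>U. \<Sum>j\<in>U. y i * M i j * y j))"
    using ins(2,3) by (simp add: sum.distrib)
  also have "(\<Sum>j\<in>U. y v * M v j * y j) = y v * s"
    unfolding s_def sum_distrib_left by (intro sum.cong refl) (use ins(3) in \<open>auto simp: y_def\<close>)
  also have "(\<Sum>i\<in>U. y i * M i v * y v) = y v * s"
    unfolding s'[symmetric] sum_distrib_left by (intro sum.cong refl) (use ins(3) in \<open>auto simp: y_def\<close>)
  also have "(\<Sum>i\<in>U. \<Sum>j\<in>U. y i * M i j * y j) = (\<Sum>i\<in>U. \<Sum>j\<in>U. x i * M i j * x j)"
    by (intro sum.cong refl) (use ins(3) in \<open>auto simp: y_def\<close>)
  also have "y v * M v v * y v + y v * s + (y v * s + (\<Sum>i\<in>U. \<Sum>j\<in>U. x i * M i j * x j))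
      = (\<Sum>i\<in>U. \<Sum>j\<in>U. x i * M i j * x j) - s * s / M v v"
    using mv by (simp add: y_def)
  also have "s * s = (\<Sum>i\<in>U. \<Sum>j\<in>U. x i * M i v * (M v j * x j))"
  proof -
    have "s * s = (\<Sum>i\<in>U. x i * M i v) * (\<Sum>j\<in>U. M v j * x j)" using s' s_def by simp
    then show ?thesis by (simp only: sum_product)
  qed
  also have "(\<Sum>i\<in>U. \<Sum>j\<in>U. x i * M i j * x j) - (\<Sum>i\<in>U. \<Sum>j\<in>U. x i * M i v * (M v j * x j)) / M v v
     = (\<Sum>i\<in>U. \<Sum>j\<in>U. x i * schur_complement v M i j * x j)"
    unfolding sum_divide_distrib sum_subtractf[symmetric]
    by (intro sum.cong refl) (simp add: schur_complement_def algebra_simps)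
  finally show "(\<Sum>i\<in>V - {v}. \<Sum>j\<in>V - {v}. x i * schur_complement v M i j * x j) > 0"
    unfolding U_def .
qed

lemma inverse_pair_on_swap:
  assumes "inverse_pair_on V M N"
  shows "inverse_pair_on V N M"
proof -
  have "(\<Sum>k\<in>V. N i k * M k j) = (if i = j then 1 else 0)" if "i \<in> V" "j \<in> V" for i j
  proof -
    have "(\<Sum>k\<in>V. N i k * M k j) = (\<Sum>k\<in>V. M j k * N k i)"
    proof (intro sum.cong refl)
      fix k assume "k \<in> V"
      then have "N i k = N k i" "M k j = M j k"
        using assms that by (auto simp: inverse_pair_on_def intro: pos_def_on_sym[of V])
      then show "N i k * M k j = M j k * N k i" by simp
    qed
    then show ?thesis using assms that by (simp add: inverse_pair_on_def)
  qed
  then show ?thesis using assms by (simp add: inverse_pair_on_def)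
qed

text \<open>Eliminating \<open>v\<close> from \<open>M\<close> by a Gaussian step is the same as deleting row and column \<open>v\<close>
  from the inverse.\<close>
lemma inverse_pair_on_schur_complement:
  assumes "inverse_pair_on V M N" "v \<in> V"
  shows "inverse_pair_on (V - {v}) (schur_complement v M) N"
proof -
  let ?U = "V - {v}"
  have fin: "finite V" and pM: "pos_def_on V M" and pN: "pos_def_on V N"
    and inv: "\<And>i j. i \<in> V \<Longrightarrow> j \<in> V \<Longrightarrow> (\<Sum>k\<in>V. M i k * N k j) = (if i = j then 1 else 0)"
    using assms(1) by (auto simp: inverse_pair_on_def)
  have mv: "M v v \<noteq> 0" using pos_def_on_diag[OF fin pM assms(2)] by simp
  have "(\<Sum>k\<in>?U. schur_complement v M i k * N k j) = (if i = j then 1 else 0)"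
    if "i \<in> ?U" "j \<in> ?U" for i j
  proof -
    have row: "(\<Sum>k\<in>?U. M l k * N k j) = (if l = j then 1 else 0) - M l v * N v j" if "l \<in> V" for l
      using inv[OF that, of j] \<open>j \<in> ?U\<close> sum.remove[OF fin assms(2), of "\<lambda>k. M l k * N k j"] by simp
    have "(\<Sum>k\<in>?U. schur_complement v M i k * N k j)
        = (\<Sum>k\<in>?U. M i k * N k j) - M i v / M v v * (\<Sum>k\<in>?U. M v k * N k j)"
      unfolding sum_distrib_left sum_subtractf[symmetric]
      by (intro sum.cong refl) (simp add: schur_complement_def algebra_simps)
    also have "\<dots> = (if i = j then 1 else 0)"
      using row[of i] row[of v] that assms(2) mv by auto
    finally show ?thesis .
  qed
  moreover have "pos_def_on ?U N" using pos_def_on_subset[OF fin pN] by blast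
  ultimately show ?thesis
    using pos_def_on_schur_complement[OF fin pM assms(2)] fin by (simp add: inverse_pair_on_def)
qed

lemma inverse_pair_on_block:
  assumes "inverse_pair_on V M N" "A \<subseteq> V" "\<And>i j. i \<in> V - A \<Longrightarrow> j \<in> A \<Longrightarrow> N i j = 0"
  shows "inverse_pair_on A M N"
proof -
  have fin: "finite V" "finite A" using assms finite_subset by (auto simp: inverse_pair_on_def)
  have "(\<Sum>k\<in>A. M i k * N k j) = (\<Sum>k\<in>V. M i k * N k j)" if "j \<in> A" for i j
    by (rule sum.mono_neutral_left) (use assms that fin in auto)
  then show ?thesis
    using assms pos_def_on_subset[of V _ A] fin by (auto simp: inverse_pair_on_def subset_iff)
qed

text \<open>Let \<open>x\<close> be column \<open>j\<close> of \<open>N\<close> cut down to \<open>A\<close>. Since \<open>M\<close> does not lead out of \<open>A\<close>, the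
  product of \<open>M\<close> and \<open>x\<close> agrees on \<open>A\<close> with column \<open>j\<close> of the identity, which vanishes there;
  so the quadratic form of \<open>M\<close> vanishes at \<open>x\<close>, and \<open>x = 0\<close>.\<close>
lemma inverse_pair_on_zero_block:
  assumes ip: "inverse_pair_on V M N" and A: "A \<subseteq> V"
    and zero: "\<And>i j. i \<in> A \<Longrightarrow> j \<in> V - A \<Longrightarrow> M i j = 0"
    and ij: "i \<in> A" "j \<in> V - A"
  shows "N i j = 0"
proof (rule ccontr)
  assume "N i j \<noteq> 0"
  have fin: "finite V" and pM: "pos_def_on V M" using ip by (auto simp: inverse_pair_on_def)
  let ?q = "\<Sum>a\<in>A. \<Sum>k\<in>A. N a j * M a k * N k j"
  have "?q > 0"
    using pos_def_on_pos[OF pos_def_on_subset[OF fin pM A] ij(1), of "\<lambda>a. N a j"] \<open>N i j \<noteq> 0\<close>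
    by simp
  moreover have "?q = (\<Sum>a\<in>A. N a j * (\<Sum>k\<in>V. M a k * N k j))"
  proof (intro sum.cong refl)
    fix a assume "a \<in> A"
    have eq: "(\<Sum>k\<in>A. M a k * N k j) = (\<Sum>k\<in>V. M a k * N k j)"
      by (rule sum.mono_neutral_left) (use fin A zero \<open>a \<in> A\<close> in auto)
    then show "(\<Sum>k\<in>A. N a j * M a k * N k j) = N a j * (\<Sum>k\<in>V. M a k * N k j)"
      unfolding eq[symmetric] sum_distrib_left by (simp add: mult.assoc)
  qed
  moreover have "(\<Sum>k\<in>V. M a k * N k j) = 0" if "a \<in> A" for a
    using ip that ij A unfolding inverse_pair_on_def by auto
  ultimately show False by simp
qed

lemma connected_on_inverse:
  assumes "inverse_pair_on V M N" "connected_on V M"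
  shows "connected_on V N"
  unfolding connected_on_def
proof (intro allI impI, rule ccontr)
  fix A assume A: "A \<subset> V \<and> A \<noteq> {}" and "\<not> (\<exists>i\<in>A. \<exists>j\<in>V - A. N i j \<noteq> 0)"
  then have "M i j = 0" if "i \<in> A" "j \<in> V - A" for i j
    using inverse_pair_on_zero_block[OF inverse_pair_on_swap[OF assms(1)], of A] that by blast
  then show False using A assms(2) unfolding connected_on_def by blast
qed

lemma inverse_pair_onD:
  assumes "inverse_pair_on V M N"
  shows "finite V" "pos_def_on V M" "pos_def_on V N"
    "\<And>i. i \<in> V \<Longrightarrow> M i i > 0" "\<And>i. i \<in> V \<Longrightarrow> N i i > 0"
  using assms pos_def_on_diag[of V] by (auto simp: inverse_pair_on_def)

section \<open>Counting nonzero entries\<close>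

lemma finite_nonzeros: "finite V \<Longrightarrow> finite {(i, j). i \<in> V \<and> j \<in> V \<and> M i j \<noteq> (0::real)}"
  by (rule finite_subset[of _ "V \<times> V"]) auto

lemma nonzeros_remove:
  assumes fin: "finite V" and pd: "pos_def_on V M" and v: "v \<in> V"
  shows "nonzeros V M = nonzeros (V - {v}) M + 1 + 2 * card (neighbours V M v)"
proof -
  let ?S = "{(i, j). i \<in> V - {v} \<and> j \<in> V - {v} \<and> M i j \<noteq> 0}" and ?D = "neighbours V M v"
  have D: "finite ?D" "v \<notin> ?D" using fin by (auto simp: neighbours_def)
  have S: "finite ?S" using finite_nonzeros[of "V - {v}" M] fin by simp
  have "{(i, j). i \<in> V \<and> j \<in> V \<and> M i j \<noteq> 0} = (?S \<union> {(v, v)}) \<union> ({v} \<times> ?D \<union> ?D \<times> {v})"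
  proof -
    have "{i \<in> V - {v}. M i v \<noteq> 0} = ?D"
      unfolding neighbours_def by (intro Collect_cong conj_cong refl) (simp add: pos_def_on_sym[OF pd _ v])
    moreover have "{(i, j). i \<in> V \<and> j \<in> V \<and> M i j \<noteq> 0}
        = (?S \<union> {(v, v)}) \<union> ({v} \<times> ?D \<union> {i \<in> V - {v}. M i v \<noteq> 0} \<times> {v})"
      using v pos_def_on_diag[OF fin pd v] by (auto simp: neighbours_def)
    ultimately show ?thesis by simp
  qed
  moreover have "card ((?S \<union> {(v, v)}) \<union> ({v} \<times> ?D \<union> ?D \<times> {v}))
      = card (?S \<union> {(v, v)}) + card ({v} \<times> ?D \<union> ?D \<times> {v})"
    by (rule card_Un_disjoint) (use D S in \<open>auto simp: neighbours_def\<close>)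
  moreover have "card (?S \<union> {(v, v)}) = card ?S + 1"
    using S by (subst card_Un_disjoint) auto
  moreover have "card ({v} \<times> ?D \<union> ?D \<times> {v}) = 2 * card ?D"
    using D by (subst card_Un_disjoint) (auto simp: card_cartesian_product)
  ultimately show ?thesis by (simp add: nonzeros_def)
qed

lemma nonzeros_eq_sum_degrees:
  assumes fin: "finite V" and pd: "pos_def_on V M"
  shows "nonzeros V M = (\<Sum>v\<in>V. 1 + card (neighbours V M v))"
proof -
  have "M v v \<noteq> 0" if "v \<in> V" for v using pos_def_on_diag[OF fin pd that] by simp
  then have "{(i, j). i \<in> V \<and> j \<in> V \<and> M i j \<noteq> 0} = (SIGMA v:V. insert v (neighbours V M v))"
    by (auto simp: neighbours_def)
  moreover have "card (insert v (neighbours V M v)) = 1 + card (neighbours V M v)" for v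
    using fin by (simp add: neighbours_def)
  ultimately show ?thesis using fin by (simp add: nonzeros_def neighbours_def)
qed

lemma nonzeros_blocks:
  assumes "finite V" "A \<subseteq> V"
    and "\<And>i j. i \<in> A \<Longrightarrow> j \<in> V - A \<Longrightarrow> M i j = 0" "\<And>i j. i \<in> V - A \<Longrightarrow> j \<in> A \<Longrightarrow> M i j = 0"
  shows "nonzeros V M = nonzeros A M + nonzeros (V - A) M"
proof -
  have "i \<in> V \<and> j \<in> V \<and> M i j \<noteq> 0 \<longleftrightarrow>
      i \<in> A \<and> j \<in> A \<and> M i j \<noteq> 0 \<or> i \<in> V - A \<and> j \<in> V - A \<and> M i j \<noteq> 0" for i j
    using assms(2-4) by blast
  then have "{(i, j). i \<in> V \<and> j \<in> V \<and> M i j \<noteq> 0} = {(i, j). i \<in> A \<and> j \<in> A \<and> M i j \<noteq> 0}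
      \<union> {(i, j). i \<in> V - A \<and> j \<in> V - A \<and> M i j \<noteq> 0}" (is "_ = ?X \<union> ?Y")
    by blast
  moreover have "card (?X \<union> ?Y) = card ?X + card ?Y"
    using finite_nonzeros[of A M] finite_nonzeros[of "V - A" M] finite_subset[OF assms(2,1)] assms(1)
    by (intro card_Un_disjoint) auto
  ultimately show ?thesis by (simp add: nonzeros_def)
qed

section \<open>The graph of a Schur complement\<close>

text \<open>Orthogonality of row \<open>v\<close> of \<open>M\<close> to column \<open>j\<close> of \<open>N\<close>. When \<open>v\<close> has few neighbours it
  relates the zero pattern of row \<open>v\<close> of \<open>N\<close> to those of the rows of its neighbours.\<close>
lemma inverse_pair_on_row:
  assumes ip: "inverse_pair_on V M N" and v: "v \<in> V" and j: "j \<in> V - {v}"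
  shows "M v v * N v j + (\<Sum>k\<in>neighbours V M v. M v k * N k j) = 0"
proof -
  have fin: "finite V" using ip by (rule inverse_pair_onD)
  have "(\<Sum>k\<in>neighbours V M v. M v k * N k j) = (\<Sum>k\<in>V - {v}. M v k * N k j)"
    by (rule sum.mono_neutral_left) (use fin in \<open>auto simp: neighbours_def\<close>)
  moreover have "(\<Sum>k\<in>V. M v k * N k j) = 0" using ip v j by (auto simp: inverse_pair_on_def)
  ultimately show ?thesis using sum.remove[OF fin v, of "\<lambda>k. M v k * N k j"] by simp
qed

text \<open>A row of \<open>M\<close> whose index is not a neighbour of \<open>v\<close> is unaffected by the elimination, so
  an edge of \<open>M\<close> that leaves \<open>D\<close> survives.\<close>
lemma schur_complement_edge:
  assumes pd: "pos_def_on V M" and conn: "connected_on V M" and v: "v \<in> V"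
    and D: "D \<subseteq> V - {v}" "D \<noteq> {}" "D \<inter> neighbours V M v = {}"
  shows "\<exists>i\<in>D. \<exists>j\<in>V - {v} - D. schur_complement v M i j \<noteq> 0"
proof -
  have "D \<subset> V" using D v by auto
  then obtain i j where ij: "i \<in> D" "j \<in> V - D" "M i j \<noteq> 0"
    using conn D(2) unfolding connected_on_def by blast
  have "M v i = 0" using ij(1) D by (auto simp: neighbours_def)
  then have "M i v = 0" using pos_def_on_sym[OF pd, of i v] ij(1) D v by auto
  then have "j \<noteq> v" "schur_complement v M i j \<noteq> 0" using ij by (auto simp: schur_complement_def)
  then show ?thesis using ij by blast
qed

text \<open>Of the two sides of a cut of \<open>A\<close>, one avoids \<open>u\<close>, hence all neighbours of \<open>v\<close>, and an
  edge leaves that side; it stays inside \<open>A\<close> because no edge leads out of \<open>A\<close>. The case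
  \<open>A = V - {v}\<close> shows that removing a leaf preserves connectedness.\<close>
lemma connected_on_schur_complement_block:
  assumes fin: "finite V" and pd: "pos_def_on V M" and conn: "connected_on V M" and v: "v \<in> V"
    and A: "A \<subseteq> V - {v}" "neighbours V M v \<inter> A \<subseteq> {u}"
    and zero: "\<And>i j. i \<in> A \<Longrightarrow> j \<in> V - {v} - A \<Longrightarrow> schur_complement v M i j = 0"
  shows "connected_on A (schur_complement v M)"
  unfolding connected_on_def
proof (intro allI impI)
  fix D assume D: "D \<subset> A \<and> D \<noteq> {}"
  show "\<exists>i\<in>D. \<exists>j\<in>A - D. schur_complement v M i j \<noteq> 0"
  proof (cases "u \<in> D")
    case False
    then have "D \<inter> neighbours V M v = {}" "D \<subseteq> V - {v}" using D A by auto
    then obtain i j where "i \<in> D" "j \<in> V - {v} - D" "schur_complement v M i j \<noteq> 0"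
      using schur_complement_edge[OF pd conn v, of D] D by blast
    then show ?thesis using zero[of i j] D by blast
  next
    case True
    have "\<exists>i\<in>A - D. \<exists>j\<in>V - {v} - (A - D). schur_complement v M i j \<noteq> 0"
      by (rule schur_complement_edge[OF pd conn v]) (use True D A in auto)
    then obtain i j where ij: "i \<in> A - D" "j \<in> V - {v} - (A - D)" "schur_complement v M i j \<noteq> 0"
      by blast
    then have "j \<in> D" using zero[of i j] by blast
    moreover have "i \<in> V - {v}" "j \<in> V - {v}" using ij A by auto
    then have "schur_complement v M j i \<noteq> 0"
      using ij pos_def_on_sym[OF pos_def_on_schur_complement[OF fin pd v], of i j] by simp
    ultimately show ?thesis using ij by blast
  qed
qed

section \<open>Removing a vertex of degree one or two\<close>

text \<open>Twice the number of nonzero entries in one row of \<open>N\<close> compensates for lowering the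
  constant from 8 to 4. A block of size at least 2 has at least two nonzero entries in the row,
  by connectedness; a block of size 1 has only one, but there the bound itself has slack 2.\<close>
lemma block_bound_row:
  assumes ip: "inverse_pair_on A M N" and conn: "connected_on A M" and w: "w \<in> A"
    and bound: "8 * card A \<le> nonzeros A M + nonzeros A N + 8"
  shows "8 * card A \<le> nonzeros A M + nonzeros A N + 2 * card {j \<in> A. N w j \<noteq> 0} + 4"
proof -
  note D = inverse_pair_onD[OF ip]
  let ?R = "{j \<in> A. N w j \<noteq> 0}"
  have finR: "finite ?R" using D(1) by simp
  have wR: "w \<in> ?R" using w D(5)[OF w] by simp
  show ?thesis
  proof (cases "A = {w}")
    case True
    have "nonzeros A M \<ge> 1" "nonzeros A N \<ge> 1"
      using nonzeros_remove[OF D(1,2) w] nonzeros_remove[OF D(1,3) w] by auto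
    moreover have "card ?R \<ge> 1" using wR finR by (auto simp: Suc_le_eq card_gt_0_iff)
    ultimately show ?thesis using True by simp
  next
    case False
    then have "{w} \<subset> A" using w by blast
    then obtain j where j: "j \<in> A - {w}" "N w j \<noteq> 0"
      using connected_on_inverse[OF ip conn] unfolding connected_on_def by blast
    then have "card {w, j} \<le> card ?R" using finR wR by (intro card_mono) auto
    then have "2 \<le> card ?R" using j by auto
    then show ?thesis using bound by simp
  qed
qed

lemma schur_complement_unchanged:
  assumes pd: "pos_def_on V M" and v: "v \<in> V" and ij: "i \<in> V - {v}" "j \<in> V - {v}"
    and "i \<notin> neighbours V M v \<or> j \<notin> neighbours V M v"
  shows "schur_complement v M i j = M i j"
proof -
  have "M v i = M i v" using ij by (intro pos_def_on_sym[OF pd v]) simp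
  then have "M i v = 0 \<or> M v j = 0" using assms(5) ij by (auto simp: neighbours_def)
  then show ?thesis by (auto simp: schur_complement_def)
qed

text \<open>Removing \<open>v\<close> removes 3 entries of \<open>M\<close>, and from \<open>N\<close> one diagonal entry and two for each
  neighbour of \<open>v\<close> in \<open>N\<close>. Row \<open>v\<close> of \<open>N\<close> is a multiple of row \<open>w\<close> off \<open>v\<close>, which makes the
  row bound applicable.\<close>
lemma leaf_step:
  assumes ip: "inverse_pair_on V M N" and conn: "connected_on V M" and v: "v \<in> V"
    and leaf: "neighbours V M v = {w}"
    and IH: "\<And>A K. inverse_pair_on A K N \<Longrightarrow> connected_on A K \<Longrightarrow> A \<subset> V \<Longrightarrow>
               8 * card A \<le> nonzeros A K + nonzeros A N + 8"
  shows "8 * card V \<le> nonzeros V M + nonzeros V N + 8"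
proof -
  note D = inverse_pair_onD[OF ip]
  let ?U = "V - {v}" and ?K = "schur_complement v M"
  have w: "w \<in> ?U" "M v w \<noteq> 0" using leaf by (auto simp: neighbours_def)
  have ipU: "inverse_pair_on ?U ?K N" using ip v by (rule inverse_pair_on_schur_complement)
  have connU: "connected_on ?U ?K"
    by (rule connected_on_schur_complement_block[OF D(1,2) conn v, where u = w]) (use leaf in auto)
  have "?K i j \<noteq> 0 \<longleftrightarrow> M i j \<noteq> 0" if "i \<in> ?U" "j \<in> ?U" for i j
  proof (cases "i = w \<and> j = w")
    case True
    then show ?thesis using inverse_pair_onD(4)[OF ipU, of w] D(4)[of w] w by auto
  next
    case False
    then show ?thesis using schur_complement_unchanged[OF D(2) v that] leaf by auto
  qed
  then have nzK: "nonzeros ?U ?K = nonzeros ?U M"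
    unfolding nonzeros_def by (intro arg_cong[of _ _ card]) auto
  have "N v j \<noteq> 0 \<longleftrightarrow> N w j \<noteq> 0" if "j \<in> ?U" for j
    using inverse_pair_on_row[OF ip v that] D(4)[OF v] w leaf by (auto simp: add_eq_0_iff)
  then have "neighbours V N v = {j \<in> ?U. N w j \<noteq> 0}" by (auto simp: neighbours_def)
  moreover have "8 * card ?U \<le> nonzeros ?U ?K + nonzeros ?U N + 2 * card {j \<in> ?U. N w j \<noteq> 0} + 4"
  proof -
    have "?U \<subset> V" using v by blast
    from block_bound_row[OF ipU connU w(1) IH[OF ipU connU this]] show ?thesis .
  qed
  moreover have "card V = Suc (card ?U)" using D(1) v by (rule card.remove)
  ultimately show ?thesis
    using nonzeros_remove[OF D(1,2) v] nonzeros_remove[OF D(1,3) v] leaf nzK by simp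
qed

text \<open>The blocks are \<open>A\<close>, containing \<open>u\<close>, and its complement, containing \<open>w\<close>. In a column of
  \<open>A\<close> row \<open>w\<close> of \<open>N\<close> vanishes, so the relation between rows \<open>v\<close>, \<open>u\<close> and \<open>w\<close> makes rows
  \<open>v\<close> and \<open>u\<close> of \<open>N\<close> nonzero together; likewise \<open>v\<close> and \<open>w\<close> in the columns of the other
  block. The nonzero entries of row \<open>v\<close> therefore pay for the row bound of both blocks. The
  sum of the two row bounds has the constant 8 on the right-hand side, as required, and concerns
  one index less, which is made up by 8 further entries: the 5 entries of \<open>M\<close>
  in the row and column of \<open>v\<close>, the diagonal entry of \<open>N\<close> at \<open>v\<close>, and the 2 entries of
  \<open>M\<close> at \<open>(u, w)\<close> and \<open>(w, u)\<close> that the Schur complement cancels.\<close>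
lemma split_step:
  assumes ip: "inverse_pair_on V M N" and conn: "connected_on V M" and v: "v \<in> V"
    and nb: "neighbours V M v = {u, w}" and uw: "u \<noteq> w"
    and nz: "nonzeros (V - {v}) (schur_complement v M) + 2 \<le> nonzeros (V - {v}) M"
    and A: "A \<subseteq> V - {v}" "u \<in> A" "w \<notin> A"
    and zero: "\<And>i j. i \<in> A \<Longrightarrow> j \<in> V - {v} - A \<Longrightarrow> schur_complement v M i j = 0"
    and IH: "\<And>A K. inverse_pair_on A K N \<Longrightarrow> connected_on A K \<Longrightarrow> A \<subset> V \<Longrightarrow>
               8 * card A \<le> nonzeros A K + nonzeros A N + 8"
  shows "8 * card V \<le> nonzeros V M + nonzeros V N + 8"
proof -
  note D = inverse_pair_onD[OF ip]
  let ?U = "V - {v}" and ?K = "schur_complement v M"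
  let ?B = "?U - A"
  have mem: "u \<in> ?U" "w \<in> ?U" "M v u \<noteq> 0" "M v w \<noteq> 0" using nb by (auto simp: neighbours_def)
  have ipU: "inverse_pair_on ?U ?K N" using ip v by (rule inverse_pair_on_schur_complement)
  note E = inverse_pair_onD[OF ipU]
  have zero': "?K i j = 0" if "i \<in> ?B" "j \<in> A" for i j
    using zero[of j i] pos_def_on_sym[OF E(2), of i j] that A by auto
  have zeroN: "N i j = 0" if "i \<in> A" "j \<in> ?B" for i j
    using inverse_pair_on_zero_block[OF ipU A(1) zero] that by blast
  have zeroN': "N i j = 0" if "i \<in> ?B" "j \<in> A" for i j
    using zeroN[of j i] pos_def_on_sym[OF E(3), of i j] that A by auto
  have ipA: "inverse_pair_on A ?K N" using inverse_pair_on_block[OF ipU A(1) zeroN'] .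
  have ipB: "inverse_pair_on ?B ?K N"
    by (rule inverse_pair_on_block[OF ipU]) (use zeroN in auto)
  have connA: "connected_on A ?K"
    by (rule connected_on_schur_complement_block[OF D(1,2) conn v, where u = u]) (use nb A zero in auto)
  have connB: "connected_on ?B ?K"
    by (rule connected_on_schur_complement_block[OF D(1,2) conn v, where u = w]) (use nb A zero' in auto)
  let ?RA = "{j \<in> A. N u j \<noteq> 0}" and ?RB = "{j \<in> ?B. N w j \<noteq> 0}"
  have bA: "8 * card A \<le> nonzeros A ?K + nonzeros A N + 2 * card ?RA + 4"
  proof -
    have "A \<subset> V" using A v by blast
    from block_bound_row[OF ipA connA A(2) IH[OF ipA connA this]] show ?thesis .
  qed
  have bB: "8 * card ?B \<le> nonzeros ?B ?K + nonzeros ?B N + 2 * card ?RB + 4"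
  proof -
    have "?B \<subset> V" "w \<in> ?B" using A v mem by blast+
    from block_bound_row[OF ipB connB this(2) IH[OF ipB connB this(1)]] show ?thesis .
  qed
  have row: "M v v * N v j + (M v u * N u j + M v w * N w j) = 0" if "j \<in> ?U" for j
    using inverse_pair_on_row[OF ip v that] nb uw by simp
  have "?RA \<union> ?RB \<subseteq> neighbours V N v"
  proof
    fix j assume j: "j \<in> ?RA \<union> ?RB"
    then have jU: "j \<in> ?U" using A by auto
    have "M v u * N u j + M v w * N w j \<noteq> 0"
      using j zeroN'[of w j] zeroN[of u j] A mem by auto
    then show "j \<in> neighbours V N v" using row[OF jU] jU by (auto simp: neighbours_def)
  qed
  then have "card (?RA \<union> ?RB) \<le> card (neighbours V N v)"
    using D(1) by (intro card_mono) (auto simp: neighbours_def)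
  moreover have "card (?RA \<union> ?RB) = card ?RA + card ?RB"
    using finite_subset[OF A(1) E(1)] E(1) by (intro card_Un_disjoint) auto
  moreover have "card V = Suc (card A + card ?B)"
  proof -
    have "card ?U = card A + card ?B"
      using A(1) E(1) by (metis Diff_partition Diff_disjoint card_Un_disjoint finite_Diff finite_subset)
    then show ?thesis using card.remove[OF D(1) v] by simp
  qed
  moreover have "nonzeros ?U ?K = nonzeros A ?K + nonzeros ?B ?K"
    using E(1) A(1) zero zero' by (rule nonzeros_blocks)
  moreover have "nonzeros ?U N = nonzeros A N + nonzeros ?B N"
    using E(1) A(1) zeroN zeroN' by (rule nonzeros_blocks)
  moreover have "card (neighbours V M v) = 2" using nb uw by simp
  ultimately show ?thesis
    using nonzeros_remove[OF D(1,2) v] nonzeros_remove[OF D(1,3) v] bA bB nz by simp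
qed

text \<open>Only the entries at \<open>(u, w)\<close> and \<open>(w, u)\<close> can change between zero and nonzero. If the
  Schur complement is nonzero there, it joins \<open>u\<close> to \<open>w\<close> and is connected, and at most two
  entries were created; these are paid for by the second neighbour of \<open>v\<close> in \<open>N\<close>. If it is zero
  there, the entry of \<open>M\<close> was nonzero and has been cancelled, so two entries are gained, and
  connectedness may fail only by separating \<open>u\<close> from \<open>w\<close>.\<close>
lemma degree_two_step:
  assumes ip: "inverse_pair_on V M N" and conn: "connected_on V M" and v: "v \<in> V"
    and nb: "neighbours V M v = {u, w}" and uw: "u \<noteq> w"
    and degN: "2 \<le> card (neighbours V N v)"
    and IH: "\<And>A K. inverse_pair_on A K N \<Longrightarrow> connected_on A K \<Longrightarrow> A \<subset> V \<Longrightarrow>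
               8 * card A \<le> nonzeros A K + nonzeros A N + 8"
  shows "8 * card V \<le> nonzeros V M + nonzeros V N + 8"
proof -
  note D = inverse_pair_onD[OF ip]
  let ?U = "V - {v}" and ?K = "schur_complement v M"
  have mem: "u \<in> ?U" "w \<in> ?U" "M v u \<noteq> 0" "M v w \<noteq> 0" using nb by (auto simp: neighbours_def)
  have ipU: "inverse_pair_on ?U ?K N" using ip v by (rule inverse_pair_on_schur_complement)
  note E = inverse_pair_onD[OF ipU]
  let ?SK = "{(i, j). i \<in> ?U \<and> j \<in> ?U \<and> ?K i j \<noteq> 0}"
  let ?SM = "{(i, j). i \<in> ?U \<and> j \<in> ?U \<and> M i j \<noteq> 0}"
  let ?P = "{(u, w), (w, u)}"
  have finS: "finite ?SK" "finite ?SM" using finite_nonzeros[OF E(1)] by blast+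
  have cP: "card ?P = 2" using uw by simp
  have same: "?K i j \<noteq> 0 \<longleftrightarrow> M i j \<noteq> 0" if "i \<in> ?U" "j \<in> ?U" "(i, j) \<notin> ?P" for i j
  proof (cases "i \<in> {u, w} \<and> i = j")
    case True
    then show ?thesis using E(4)[of i] D(4)[of i] that by auto
  next
    case False
    then have "i \<notin> neighbours V M v \<or> j \<notin> neighbours V M v" using that(3) nb by auto
    from schur_complement_unchanged[OF D(2) v that(1,2) this] show ?thesis by simp
  qed
  have symK: "?K w u = ?K u w" using pos_def_on_sym[OF E(2)] mem by blast
  have cardV: "card V = Suc (card ?U)" using D(1) v by (rule card.remove)
  have degM: "card (neighbours V M v) = 2" using nb uw by simp
  have conn_case: ?thesis if "connected_on ?U ?K" "nonzeros ?U ?K \<le> nonzeros ?U M + 2"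
  proof -
    have "?U \<subset> V" using v by blast
    from IH[OF ipU that(1) this] show ?thesis
      using that(2) nonzeros_remove[OF D(1,2) v] nonzeros_remove[OF D(1,3) v] degM degN cardV
      by linarith
  qed
  \<comment> \<open>A cut of the Schur complement without edges must separate \<open>u\<close> from \<open>w\<close>, as a side that
    avoids both keeps its edges.\<close>
  have cut: "u \<in> A \<and> w \<in> ?U - A \<or> w \<in> A \<and> u \<in> ?U - A"
    if A: "A \<subset> ?U" "A \<noteq> {}" and zero: "\<And>i j. i \<in> A \<Longrightarrow> j \<in> ?U - A \<Longrightarrow> ?K i j = 0" for A
  proof -
    have "A \<inter> {u, w} \<noteq> {}"
      using schur_complement_edge[OF D(2) conn v, of A] A zero nb by blast
    moreover have "(?U - A) \<inter> {u, w} \<noteq> {}"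
    proof
      assume "(?U - A) \<inter> {u, w} = {}"
      then obtain i j where "i \<in> ?U - A" "j \<in> A" "?K i j \<noteq> 0"
        using schur_complement_edge[OF D(2) conn v, of "?U - A"] A nb by blast
      then show False using zero[of j i] pos_def_on_sym[OF E(2), of i j] A by auto
    qed
    ultimately show ?thesis by blast
  qed
  show ?thesis
  proof (cases "?K u w = 0")
    case False
    have "connected_on ?U ?K"
      unfolding connected_on_def
    proof (intro allI impI, rule ccontr)
      fix A assume "A \<subset> ?U \<and> A \<noteq> {}" "\<not> (\<exists>i\<in>A. \<exists>j\<in>?U - A. ?K i j \<noteq> 0)"
      then show False using cut[of A] False symK by metis
    qed
    moreover have "card ?SK \<le> card (?SM \<union> ?P)"
      using finS same by (intro card_mono) auto
    then have "nonzeros ?U ?K \<le> nonzeros ?U M + 2"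
      using card_Un_le[of ?SM ?P] cP by (simp add: nonzeros_def)
    ultimately show ?thesis by (rule conn_case)
  next
    case True
    then have "M u w \<noteq> 0" using mem pos_def_on_sym[OF D(2), of u v] v D(4)[OF v]
      by (auto simp: schur_complement_def)
    then have "?P \<subseteq> ?SM" using mem pos_def_on_sym[OF D(2), of u w] by auto
    then have "card (?SK \<union> ?P) \<le> card ?SM"
      using finS same True symK by (intro card_mono) auto
    moreover have "card (?SK \<union> ?P) = card ?SK + card ?P"
      using finS True symK by (intro card_Un_disjoint) auto
    ultimately have nz: "nonzeros ?U ?K + 2 \<le> nonzeros ?U M" using cP by (simp add: nonzeros_def)
    show ?thesis
    proof (cases "connected_on ?U ?K")
      case True
      then show ?thesis using conn_case nz by simp
    next
      case False
      then obtain A where A: "A \<subset> ?U" "A \<noteq> {}"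
        and zero: "\<And>i j. i \<in> A \<Longrightarrow> j \<in> ?U - A \<Longrightarrow> ?K i j = 0"
        unfolding connected_on_def by blast
      from cut[OF A zero] consider "u \<in> A" "w \<notin> A" | "w \<in> A" "u \<notin> A" by blast
      then show ?thesis
      proof cases
        case 1
        show ?thesis by (rule split_step[OF ip conn v nb uw nz _ 1 zero IH]) (use A in auto)
      next
        case 2
        have nb': "neighbours V M v = {w, u}" using nb by auto
        show ?thesis by (rule split_step[OF ip conn v nb' uw[symmetric] nz _ 2 zero IH]) (use A in auto)
      qed
    qed
  qed
qed

section \<open>The bound for inverse pairs\<close>

lemma degree_positive:
  assumes conn: "connected_on V M" and fin: "finite V" and card: "card V \<ge> 2" and v: "v \<in> V"
  shows "card (neighbours V M v) \<ge> 1"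
proof -
  have "{v} \<noteq> V" using card by auto
  then have "{v} \<subset> V" using v by blast
  then have "neighbours V M v \<noteq> {}"
    using conn unfolding connected_on_def neighbours_def by blast
  then show ?thesis using fin by (simp add: Suc_le_eq card_gt_0_iff neighbours_def)
qed

lemma low_degree_step:
  assumes ip: "inverse_pair_on V M N" and conn: "connected_on V M" and v: "v \<in> V"
    and deg: "card (neighbours V M v) = 1 \<or> card (neighbours V M v) = 2 \<and> 2 \<le> card (neighbours V N v)"
    and IH: "\<And>A K. inverse_pair_on A K N \<Longrightarrow> connected_on A K \<Longrightarrow> A \<subset> V \<Longrightarrow>
               8 * card A \<le> nonzeros A K + nonzeros A N + 8"
  shows "8 * card V \<le> nonzeros V M + nonzeros V N + 8"
  using deg
proof
  assume "card (neighbours V M v) = 1"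
  then obtain w where "neighbours V M v = {w}" by (auto simp: card_1_singleton_iff)
  then show ?thesis using leaf_step[OF ip conn v _ IH] by blast
next
  assume deg: "card (neighbours V M v) = 2 \<and> 2 \<le> card (neighbours V N v)"
  then obtain u w where "neighbours V M v = {u, w}" "u \<noteq> w" by (auto simp: card_2_iff)
  then show ?thesis using degree_two_step[OF ip conn v _ _ _ IH] deg by blast
qed

text \<open>A vertex of degree 2 in one graph is usable only if its degree in the other is at least 2;
  if not, that degree is 1 and the roles of \<open>M\<close> and \<open>N\<close> are exchanged.\<close>
lemma inverse_pair_on_nonzeros:
  assumes "inverse_pair_on V M N" "connected_on V M"
  shows "8 * card V \<le> nonzeros V M + nonzeros V N + 8"
  using assms
proof (induction "card V" arbitrary: V M N rule: less_induct)
  case less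
  note ip = less.prems(1) and conn = less.prems(2)
  note ip' = inverse_pair_on_swap[OF ip] and conn' = connected_on_inverse[OF ip conn]
  note D = inverse_pair_onD[OF ip]
  have IH: "8 * card A \<le> nonzeros A K + nonzeros A L + 8"
    if "inverse_pair_on A K L" "connected_on A K" "A \<subset> V" for A K L
    using less.hyps[OF psubset_card_mono[OF D(1) that(3)] that(1,2)] .
  show ?case
  proof (cases "card V \<ge> 2")
    case False
    then show ?thesis by simp
  next
    case True
    have pos: "card (neighbours V M v) \<ge> 1" "card (neighbours V N v) \<ge> 1" if "v \<in> V" for v
      using degree_positive[OF conn D(1) True that] degree_positive[OF conn' D(1) True that]
      by auto
    show ?thesis
    proof (cases "\<forall>v\<in>V. card (neighbours V M v) \<ge> 3 \<and> card (neighbours V N v) \<ge> 3")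
      case True
      have "(\<Sum>v\<in>V. 4) \<le> (\<Sum>v\<in>V. 1 + card (neighbours V M v))"
        "(\<Sum>v\<in>V. 4) \<le> (\<Sum>v\<in>V. 1 + card (neighbours V N v))"
        using True by (intro sum_mono; force)+
      then show ?thesis
        using nonzeros_eq_sum_degrees[OF D(1,2)] nonzeros_eq_sum_degrees[OF D(1,3)] by simp
    next
      case False
      then obtain v where v: "v \<in> V"
        and low: "card (neighbours V M v) < 3 \<or> card (neighbours V N v) < 3"
        by (auto simp: not_le)
      let ?a = "card (neighbours V M v)" and ?b = "card (neighbours V N v)"
      consider "?a = 1 \<or> ?a = 2 \<and> 2 \<le> ?b" | "?b = 1 \<or> ?b = 2 \<and> 2 \<le> ?a"
        using low pos[OF v] by linarith
      then show ?thesis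
      proof cases
        case 1
        then show ?thesis using IH by (intro low_degree_step[OF ip conn v]) auto
      next
        case 2
        have "8 * card V \<le> nonzeros V N + nonzeros V M + 8"
          using 2 IH by (intro low_degree_step[OF ip' conn' v]) auto
        then show ?thesis by simp
      qed
    qed
  qed
qed

section \<open>Translation to matrices\<close>

lemma nnz_eq_nonzeros:
  assumes "M \<in> carrier_mat n n"
  shows "nnz M = nonzeros {0..<n} (\<lambda>i j. M $$ (i, j))"
  using assms by (simp add: nnz_def nonzeros_def)

lemma pos_def_on_entries:
  assumes M: "M \<in> carrier_mat n n" and pd: "positive_definite_mat M"
  shows "pos_def_on {0..<n} (\<lambda>i j. M $$ (i, j))"
  unfolding pos_def_on_def
proof (intro conjI ballI allI impI)
  fix i j assume "i \<in> {0..<n}" "j \<in> {0..<n}"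
  moreover have "transpose_mat M = M" using pd by (simp add: positive_definite_mat_def)
  ultimately show "M $$ (i, j) = M $$ (j, i)" using M by (metis atLeastLessThan_iff carrier_matD index_transpose_mat(1))
next
  fix x :: "nat \<Rightarrow> real" assume x: "\<exists>i\<in>{0..<n}. x i \<noteq> 0"
  have "vec n x \<noteq> 0\<^sub>v n" using x by (auto simp: vec_eq_iff)
  then have "0 < vec n x \<bullet> (M *\<^sub>v vec n x)" using pd M by (simp add: positive_definite_mat_def)
  also have "\<dots> = (\<Sum>i\<in>{0..<n}. \<Sum>j\<in>{0..<n}. x i * M $$ (i, j) * x j)"
    using M by (simp add: scalar_prod_def sum_distrib_left mult.assoc)
  finally show "0 < (\<Sum>i\<in>{0..<n}. \<Sum>j\<in>{0..<n}. x i * M $$ (i, j) * x j)" .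
qed

text \<open>With \<open>w = N v\<close> one has \<open>v = M w\<close>, so the quadratic form of \<open>N\<close> at \<open>v\<close> is that of \<open>M\<close>
  at \<open>w\<close>.\<close>
lemma positive_definite_mat_right_inverse:
  assumes M: "M \<in> carrier_mat n n" and pd: "positive_definite_mat M"
    and N: "N \<in> carrier_mat n n" and MN: "M * N = 1\<^sub>m n"
  shows "positive_definite_mat N"
  unfolding positive_definite_mat_def
proof (intro conjI ballI impI)
  show "square_mat N" using N by simp
  have "transpose_mat N * M = 1\<^sub>m n"
    using transpose_mult[OF M N] MN pd by (simp add: positive_definite_mat_def)
  then have "transpose_mat N = transpose_mat N * (M * N)" using MN N by simp
  also have "\<dots> = transpose_mat N * M * N" using M N by (simp add: assoc_mult_mat[of _ n n _ n _ n])
  also have "\<dots> = N" using \<open>transpose_mat N * M = 1\<^sub>m n\<close> N by simp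
  finally show "transpose_mat N = N" .
next
  fix v :: "real vec" assume "v \<in> carrier_vec (dim_row N)" "v \<noteq> 0\<^sub>v (dim_row N)"
  then have v: "v \<in> carrier_vec n" "v \<noteq> 0\<^sub>v n" using N by auto
  have Nv: "N *\<^sub>v v \<in> carrier_vec n" using N v by simp
  have MNv: "M *\<^sub>v (N *\<^sub>v v) = v" using assoc_mult_mat_vec[OF M N v(1)] MN v by simp
  moreover have "M *\<^sub>v 0\<^sub>v n = 0\<^sub>v n" using M by (intro eq_vecI) auto
  ultimately have "N *\<^sub>v v \<noteq> 0\<^sub>v n" using v by auto
  then have "0 < (N *\<^sub>v v) \<bullet> (M *\<^sub>v (N *\<^sub>v v))"
    using pd M Nv by (simp add: positive_definite_mat_def)
  then show "v \<bullet> (N *\<^sub>v v) > 0" using MNv comm_scalar_prod[OF Nv v(1)] by simp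
qed

lemma inverse_pair_on_entries:
  assumes M: "M \<in> carrier_mat n n" and pd: "positive_definite_mat M"
    and N: "N \<in> carrier_mat n n" and MN: "M * N = 1\<^sub>m n"
  shows "inverse_pair_on {0..<n} (\<lambda>i j. M $$ (i, j)) (\<lambda>i j. N $$ (i, j))"
proof -
  have "(\<Sum>k\<in>{0..<n}. M $$ (i, k) * N $$ (k, j)) = (if i = j then 1 else 0)" if "i < n" "j < n" for i j
  proof -
    have "(M * N) $$ (i, j) = (\<Sum>k\<in>{0..<n}. M $$ (i, k) * N $$ (k, j))"
      using M N that by (simp add: scalar_prod_def)
    then show ?thesis using MN that by simp
  qed
  then show ?thesis
    using pos_def_on_entries[OF M pd] pos_def_on_entries[OF N positive_definite_mat_right_inverse[OF assms]]
    by (simp add: inverse_pair_on_def)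
qed

lemma permutation_initial_segment:
  assumes A: "A \<subseteq> {0..<n}" and k: "card A = k"
  obtains p where "p permutes {0..<n}" "p ` {0..<k} = A" "p ` {k..<n} = {0..<n} - A"
proof -
  have fin: "finite A" using A finite_subset by blast
  have kn: "k \<le> n" using card_mono[OF _ A] k by simp
  obtain f where f: "bij_betw f {0..<k} A"
    using ex_bij_betw_nat_finite[OF fin] k by blast
  have "card ({0..<n} - A) = card {k..<n}" using card_Diff_subset[OF fin A] k by simp
  then obtain g where g: "bij_betw g {k..<n} ({0..<n} - A)"
    using finite_same_card_bij[of "{k..<n}" "{0..<n} - A"] by auto
  define p where "p i = (if i < k then f i else if i < n then g i else i)" for i
  have pf: "bij_betw p {0..<k} A" using f by (subst bij_betw_cong[of _ _ f]) (auto simp: p_def)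
  have pg: "bij_betw p {k..<n} ({0..<n} - A)"
    using g by (subst bij_betw_cong[of _ _ g]) (auto simp: p_def)
  have "bij_betw p ({0..<k} \<union> {k..<n}) (A \<union> ({0..<n} - A))"
    using pf pg by (rule bij_betw_combine) auto
  moreover have "{0..<k} \<union> {k..<n} = {0..<n}" "A \<union> ({0..<n} - A) = {0..<n}" using kn A by auto
  ultimately have "p permutes {0..<n}"
    by (intro bij_imp_permutes) (use kn in \<open>auto simp: p_def\<close>)
  then show ?thesis using that pf pg by (auto simp: bij_betw_def)
qed

lemma permutation_mat_conj_index:
  fixes M :: "'a :: comm_ring_1 mat"
  assumes M: "M \<in> carrier_mat n n" and p: "p permutes {0..<n}" and ij: "i < n" "j < n"
    and P: "P = mat n n (\<lambda>(i, j). if j = p i then 1 else 0)"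
  shows "(P * M * transpose_mat P) $$ (i, j) = M $$ (p i, p j)"
proof -
  have pi: "p i < n" if "i < n" for i using permutes_in_image[OF p, of i] that by simp
  have PM: "(P * M) $$ (i, k) = M $$ (p i, k)" if "k < n" for k
  proof -
    have "(P * M) $$ (i, k) = (\<Sum>l\<in>{0..<n}. (if l = p i then 1 else 0) * M $$ (l, k))"
      using M ij that by (simp add: P scalar_prod_def)
    also have "\<dots> = (\<Sum>l\<in>{0..<n}. if l = p i then M $$ (l, k) else 0)"
      by (intro sum.cong) auto
    finally show ?thesis using pi ij by simp
  qed
  have "(P * M * transpose_mat P) $$ (i, j) = (\<Sum>k\<in>{0..<n}. (P * M) $$ (i, k) * P $$ (j, k))"
    using M ij by (simp add: P scalar_prod_def)
  also have "\<dots> = (\<Sum>k\<in>{0..<n}. if k = p j then M $$ (p i, k) else 0)"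
  proof (intro sum.cong refl)
    fix k assume "k \<in> {0..<n}"
    then show "(P * M) $$ (i, k) * P $$ (j, k) = (if k = p j then M $$ (p i, k) else 0)"
      unfolding P[THEN arg_cong[of _ _ "\<lambda>Q. Q $$ (j, k)"]] using PM[of k] ij by simp
  qed
  finally show ?thesis using pi ij by simp
qed

text \<open>If no entry of \<open>M\<close> leads from \<open>A\<close> to its complement, list the complement first: the lower
  left block of the permuted matrix then has rows in \<open>A\<close> and columns outside, so it is zero.\<close>
lemma irreducible_mat_connected_on:
  fixes M :: "real mat"
  assumes M: "M \<in> carrier_mat n n" and irr: "irreducible_mat M"
  shows "connected_on {0..<n} (\<lambda>i j. M $$ (i, j))"
  unfolding connected_on_def
proof (intro allI impI, rule ccontr)
  fix A assume A: "A \<subset> {0..<n} \<and> A \<noteq> {}"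
    and "\<not> (\<exists>i\<in>A. \<exists>j\<in>{0..<n} - A. M $$ (i, j) \<noteq> 0)"
  then have zero: "M $$ (i, j) = 0" if "i \<in> A" "j \<in> {0..<n} - A" for i j using that by blast
  let ?B = "{0..<n} - A"
  define k where "k = card ?B"
  have "?B \<noteq> {}" using A by blast
  then have k: "0 < k" by (simp add: k_def card_gt_0_iff)
  have "k < n" using psubset_card_mono[of "{0..<n}" ?B] A by (auto simp: k_def)
  then obtain m where m: "n = k + m" "0 < m" by (metis less_imp_add_positive)
  obtain p where p: "p permutes {0..<n}" "p ` {0..<k} = ?B" "p ` {k..<n} = {0..<n} - ?B"
    using permutation_initial_segment[of ?B n k] k_def by auto
  define P :: "real mat" where "P = mat n n (\<lambda>(i, j). if j = p i then 1 else 0)"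
  let ?C = "P * M * transpose_mat P"
  have C: "?C \<in> carrier_mat (k + m) (k + m)" using m by (intro carrier_matI) (simp_all add: P_def)
  obtain A11 A12 A21 A22 where split: "split_block ?C k k = (A11, A12, A21, A22)"
    by (metis prod_cases4)
  note blocks = split_block[OF split carrier_matD[OF C]]
  have "A21 = 0\<^sub>m m k"
  proof (rule eq_matI)
    fix i j assume "i < dim_row (0\<^sub>m m k)" "j < dim_col (0\<^sub>m m k)"
    then have ij: "i < m" "j < k" by auto
    have "A21 $$ (i, j) = ?C $$ (i + k, j)"
      using split ij C by (auto simp: split_block_def Let_def)
    also have "\<dots> = M $$ (p (i + k), p j)"
      by (rule permutation_mat_conj_index[OF M p(1) _ _ P_def]) (use ij m in auto)
    also have "\<dots> = 0"
    proof (rule zero)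
      have "p (i + k) \<in> {0..<n} - ?B" unfolding p(3)[symmetric] using ij m by auto
      then show "p (i + k) \<in> A" by blast
      show "p j \<in> ?B" unfolding p(2)[symmetric] using ij by auto
    qed
    finally show "A21 $$ (i, j) = 0\<^sub>m m k $$ (i, j)" using ij by simp
  qed (use blocks(3) C in auto)
  then have "?C = four_block_mat A11 A12 (0\<^sub>m m k) A22" using blocks(5) by simp
  moreover have "permutation_mat (k + m) P"
    unfolding permutation_mat_def m(1)[symmetric] using p(1) P_def by blast
  moreover have "M \<in> carrier_mat (k + m) (k + m)" using M m by simp
  ultimately have "reducible_mat M"
    unfolding reducible_mat_def using k m(2) blocks(1,2,4) by blast
  then show False using irr by (simp add: irreducible_mat_def)
qed

theorem theorem2p9:
  fixes M :: "real mat" and n :: nat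
  assumes "n \<ge> 1"
    and "M \<in> carrier_mat n n"
    and "irreducible_mat M"
    and "positive_definite_mat M"
  shows "nnz M + nnz (the (mat_inverse M)) \<ge> 8 * n - 8"
proof -
  note inv = positive_definite_mat_inverse(2,3)[OF assms(2,4)]
  have "8 * card {0..<n} \<le> nnz M + nnz (the (mat_inverse M)) + 8"
    unfolding nnz_eq_nonzeros[OF assms(2)] nnz_eq_nonzeros[OF inv(1)]
    by (rule inverse_pair_on_nonzeros[OF inverse_pair_on_entries[OF assms(2,4) inv]
          irreducible_mat_connected_on[OF assms(2,3)]])
  then show ?thesis by simp
qed

end
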